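(* If $P\in\mathcal I(2)$ is nonzero, indecomposable, and of p-degree $d$, then $d\le 2N(P)-5$.
   Context: $S(X)=X_0+X_1+\dots+X_n$. $\mathcal I(n)$ denotes the set of homogeneous polynomials $P\in\mathbb R[X_0,\dots,X_n]$ with $P(X)=0$ whenever $S(X)=0$. $N(P)$ is the number of distinct monomials of $P$ with nonzero coefficient. The p-degree of $P$ is the smallest integer $d$ such that $P=X^\alpha R$ for some monomial $X^\alpha$ and some polynomial $R$ of degree $d$. $P\in\mathcal I(n)$ is indecomposable if one cannot write $P=P_1+P_2$ with $P_1,P_2\in\mathcal I(n)$ both nonzero and having no monomial in common. *)

theory Defs
  imports Complex_Main
begin

text \<open>Polynomials in the variables X_0,...,X_n with real coefficients are represented
by their coefficient functions: a monomial X^a is an exponent vector a :: nat => nat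
(with a i = 0 for i > n), and a polynomial is a map from monomials to coefficients with
finite support, supported on monomials in X_0..X_n.\<close>

type_synonym mono = "nat \<Rightarrow> nat"
type_synonym rpoly = "mono \<Rightarrow> real"

definition is_mono :: "nat \<Rightarrow> mono \<Rightarrow> bool" where
  "is_mono n a \<longleftrightarrow> (\<forall>i>n. a i = 0)"

definition supp :: "rpoly \<Rightarrow> mono set" where
  "supp P = {a. P a \<noteq> 0}"

definition is_poly :: "nat \<Rightarrow> rpoly \<Rightarrow> bool" where
  "is_poly n P \<longleftrightarrow> finite (supp P) \<and> (\<forall>a\<in>supp P. is_mono n a)"

definition tdeg :: "nat \<Rightarrow> mono \<Rightarrow> nat" where
  "tdeg n a = (\<Sum>i\<le>n. a i)"

text \<open>Total degree (degree of the zero polynomial is taken to be 0).\<close>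
definition poly_degree :: "nat \<Rightarrow> rpoly \<Rightarrow> nat" where
  "poly_degree n P = Max (insert 0 (tdeg n ` supp P))"

definition homogeneous :: "nat \<Rightarrow> rpoly \<Rightarrow> bool" where
  "homogeneous n P \<longleftrightarrow> (\<exists>k. \<forall>a\<in>supp P. tdeg n a = k)"

definition eval :: "nat \<Rightarrow> rpoly \<Rightarrow> (nat \<Rightarrow> real) \<Rightarrow> real" where
  "eval n P x = (\<Sum>a\<in>supp P. P a * (\<Prod>i\<le>n. x i ^ a i))"

definition I_set :: "nat \<Rightarrow> rpoly set" where
  "I_set n = {P. is_poly n P \<and> homogeneous n P \<and>
     (\<forall>x::nat \<Rightarrow> real. (\<Sum>i\<le>n. x i) = 0 \<longrightarrow> eval n P x = 0)}"

definition Nmon :: "rpoly \<Rightarrow> nat" where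
  "Nmon P = card (supp P)"

definition mono_mult :: "mono \<Rightarrow> rpoly \<Rightarrow> rpoly" where
  "mono_mult \<alpha> R = (\<lambda>a. if (\<forall>i. \<alpha> i \<le> a i) then R (\<lambda>i. a i - \<alpha> i) else 0)"

definition p_degree :: "nat \<Rightarrow> rpoly \<Rightarrow> nat" where
  "p_degree n P = (LEAST d. \<exists>\<alpha> R. is_mono n \<alpha> \<and> is_poly n R \<and>
       P = mono_mult \<alpha> R \<and> poly_degree n R = d)"

definition indecomposable :: "nat \<Rightarrow> rpoly \<Rightarrow> bool" where
  "indecomposable n P \<longleftrightarrow> P \<in> I_set n \<and>
     \<not> (\<exists>P1 P2. P1 \<in> I_set n \<and> P2 \<in> I_set n \<and> P1 \<noteq> (\<lambda>_. 0) \<and> P2 \<noteq> (\<lambda>_. 0) \<and>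
          P = (\<lambda>a. P1 a + P2 a) \<and> supp P1 \<inter> supp P2 = {})"

end

theory Submission
  imports Defs "HOL-Computational_Algebra.Polynomial"
begin

text \<open>
  Write $P = S Q$. Setting $X_2 = 1$ turns the exponents into points of a triangular lattice, and
  the coefficient of $P$ at a point is the sum of the coefficients of $Q$ over the three corners of
  a small triangle. Indecomposability makes the support $K$ of $Q$ connected. If all nonzero
  coefficients in a triangle have the same sign, the coefficient of $P$ there cannot vanish, so it
  suffices to count such triangles. Each lattice edge lies in exactly one triangle of either
  orientation, and every full triangle of the other orientation has an edge whose ends have
  the same sign; comparing the two counts of these edges gives a bound in terms of $K$ alone.
  That bound is evaluated by sweeping $K$ row by row, from large to small exponents of $X_0$, and
  following the shadow that the part of $K$ already swept casts on the current row: the shadow on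
  the last row has as many points as the side of the smallest triangle containing $K$.
\<close>

section \<open>Runs of finite sets of integers\<close>

text \<open>One step of the sweep: a point \<open>y\<close> of a row casts the points
  \<open>y\<close> and \<open>y + 1\<close> on the row below.\<close>

definition up :: "int set \<Rightarrow> int set" where
  "up U = {y. y \<in> U \<or> y - 1 \<in> U}"

text \<open>Each maximal run of consecutive integers is represented by its lowest element.\<close>

definition runs :: "int set \<Rightarrow> nat" where
  "runs U = card {y \<in> U. y - 1 \<notin> U}"

lemma card_shift: "card {y::int. y - 1 \<in> U} = card U"
proof -
  have "{y. y - 1 \<in> U} = (\<lambda>y. y + 1) ` U"
    by (auto simp: image_iff) (metis diff_add_cancel)
  then show ?thesis by (simp add: card_image inj_on_def)
qed

lemma finite_shift: "finite U \<Longrightarrow> finite {y::int. y - 1 \<in> U}"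
proof -
  assume "finite U"
  have "{y. y - 1 \<in> U} = (\<lambda>y. y + 1) ` U"
    by (auto simp: image_iff) (metis diff_add_cancel)
  then show ?thesis using \<open>finite U\<close> by simp
qed

lemma up_eq: "up U = U \<union> {y. y - 1 \<in> U}"
  by (auto simp: up_def)

lemma finite_up: "finite U \<Longrightarrow> finite (up U)"
  by (simp add: up_eq finite_shift)

lemma runs_add:
  assumes "finite U"
  shows "runs U + card {y \<in> U. y - 1 \<in> U} = card U"
proof -
  have "card U = card ({y \<in> U. y - 1 \<notin> U} \<union> {y \<in> U. y - 1 \<in> U})"
    by (rule arg_cong[where f=card]) auto
  also have "\<dots> = runs U + card {y \<in> U. y - 1 \<in> U}"
    unfolding runs_def using assms by (subst card_Un_disjoint) auto
  finally show ?thesis by simp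
qed

lemma runs_ends:
  assumes "finite U"
  shows "card {y. y - 1 \<in> U \<and> y \<notin> U} = runs U"
proof -
  have "card {y. y - 1 \<in> U} = card ({y. y - 1 \<in> U \<and> y \<notin> U} \<union> {y \<in> U. y - 1 \<in> U})"
    by (rule arg_cong[where f=card]) auto
  also have "\<dots> = card {y. y - 1 \<in> U \<and> y \<notin> U} + card {y \<in> U. y - 1 \<in> U}"
    using assms finite_subset[OF _ finite_shift[OF assms], of "{y. y - 1 \<in> U \<and> y \<notin> U}"]
    by (subst card_Un_disjoint) auto
  finally show ?thesis using runs_add[OF assms] by (simp add: card_shift)
qed

text \<open>Every run gains exactly one candidate, the point just above its upper end, and
  \<open>runs_ends\<close> counts these points.\<close>

lemma card_up:
  assumes "finite U"
  shows "card (up U) = card U + runs U"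
proof -
  have "up U = U \<union> {y. y - 1 \<in> U \<and> y \<notin> U}" by (auto simp: up_def)
  then have "card (up U) = card U + card {y. y - 1 \<in> U \<and> y \<notin> U}"
    using assms finite_subset[OF _ finite_shift[OF assms], of "{y. y - 1 \<in> U \<and> y \<notin> U}"]
    by (auto intro!: card_Un_disjoint)
  then show ?thesis by (simp add: runs_ends assms)
qed

lemma runs_up_le:
  assumes "finite U"
  shows "runs (up U) \<le> runs U"
  unfolding runs_def using assms by (auto intro!: card_mono simp: up_def)

lemma runs_Un_le:
  assumes "finite U" "finite V"
  shows "runs (U \<union> V) \<le> runs U + card V"
proof -
  have "runs (U \<union> V) \<le> card ({y \<in> U. y - 1 \<notin> U} \<union> V)"
    unfolding runs_def using assms by (intro card_mono) auto
  also have "\<dots> \<le> runs U + card V" unfolding runs_def by (rule card_Un_le)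
  finally show ?thesis .
qed

text \<open>If every run of \<open>U\<close> contains a point of \<open>V\<close>, then sending the
  start of the run to the first such point gives an injection into the starts of runs of
  \<open>V\<close>: the point below the image is either outside \<open>U\<close> or excluded by
  minimality.\<close>

lemma runs_le_if_meets:
  assumes "finite V" "V \<subseteq> U"
    and meets: "\<And>y. y \<in> U \<Longrightarrow> y - 1 \<notin> U \<Longrightarrow> \<exists>v\<in>V. y \<le> v \<and> {y..v} \<subseteq> U"
  shows "runs U \<le> runs V"
proof -
  define first where "first y = Min {v \<in> V. y \<le> v}" for y
  let ?S = "{y \<in> U. y - 1 \<notin> U}"
  have first: "first y \<in> V \<and> y \<le> first y \<and> {y..first y} \<subseteq> U \<and> first y - 1 \<notin> V"
    if y: "y \<in> ?S" for y
  proof -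
    obtain v where v: "v \<in> V" "y \<le> v" "{y..v} \<subseteq> U" using meets[of y] y by blast
    have fin: "finite {v \<in> V. y \<le> v}" using assms(1) by simp
    have mem: "first y \<in> {v \<in> V. y \<le> v}"
      unfolding first_def using v fin by (intro Min_in) auto
    have le: "first y \<le> w" if "w \<in> V" "y \<le> w" for w
      unfolding first_def using that fin by (intro Min_le) auto
    have "first y - 1 \<notin> V"
    proof
      assume h: "first y - 1 \<in> V"
      show False
      proof (cases "first y = y")
        case True
        then show ?thesis using h y assms(2) by auto
      next
        case False
        then show ?thesis using le[OF h] mem by auto
      qed
    qed
    moreover have "{y..first y} \<subseteq> U" using v(3) le[OF v(1,2)] by auto
    ultimately show ?thesis using mem by auto
  qed
  have "inj_on first ?S"
  proof (rule inj_onI)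
    fix y z assume y: "y \<in> ?S" and z: "z \<in> ?S" and eq: "first y = first z"
    show "y = z"
    proof (rule ccontr)
      assume "y \<noteq> z"
      then consider "y < z" | "z < y" by linarith
      then show False
      proof cases
        case 1
        then have "z - 1 \<in> {y..first y}" using first[OF z] eq by auto
        then show False using first[OF y] z by blast
      next
        case 2
        then have "y - 1 \<in> {z..first z}" using first[OF y] eq by auto
        then show False using first[OF z] y by blast
      qed
    qed
  qed
  moreover have "first ` ?S \<subseteq> {y \<in> V. y - 1 \<notin> V}" using first by blast
  ultimately show ?thesis unfolding runs_def using assms(1)
    by (intro card_inj_on_le[where f=first]) auto
qed

section \<open>Two adjacent rows\<close>

definition nz :: "(int \<Rightarrow> real) \<Rightarrow> int set" where
  "nz a = {y. a y \<noteq> 0}"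

definition same_sign_pairs :: "(int \<Rightarrow> real) \<Rightarrow> nat" where
  "same_sign_pairs a = card {y. 0 < a (y - 1) * a y}"

text \<open>With vertices \<open>A\<close> and \<open>B\<close>, their lattice edges and their full
  triangles, the strip has Euler characteristic \<open>runs A + runs B - card (A \<inter> up B) +
  card {y \<in> B. y \<in> A \<and> y + 1 \<in> A}\<close>. The bound holds because the pairs of
  neighbours in \<open>A\<close> and the pairs cast by single points of \<open>B\<close> are pairs
  of neighbours in \<open>A \<union> up B\<close>, and the two kinds coincide exactly at the
  triangles in the last term.\<close>

lemma runs_strip:
  assumes "finite A" "finite B"
  shows "card (A \<inter> up B) + runs (A \<union> up B)
    \<le> runs A + runs B + card {y \<in> B. y \<in> A \<and> y + 1 \<in> A}"
proof -
  let ?U = "A \<union> up B"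
  let ?X = "{y \<in> A. y - 1 \<in> A}" and ?B = "{y. y - 1 \<in> B}"
  have fin: "finite ?U" "finite ?X" "finite ?B"
    using assms by (auto simp: finite_up finite_shift)
  have "card ?X + card ?B = card (?X \<union> ?B) + card (?X \<inter> ?B)"
    using fin by (intro card_Un_Int)
  moreover have "card (?X \<union> ?B) \<le> card {y \<in> ?U. y - 1 \<in> ?U}"
    using fin by (intro card_mono) (auto simp: up_def)
  moreover have "card (?X \<inter> ?B) = card {y \<in> B. y \<in> A \<and> y + 1 \<in> A}"
  proof -
    have "?X \<inter> ?B = {y. y - 1 \<in> {y \<in> B. y \<in> A \<and> y + 1 \<in> A}}" by auto
    then show ?thesis by (simp only: card_shift)
  qed
  moreover have "card A + card (up B) = card ?U + card (A \<inter> up B)"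
    using assms by (intro card_Un_Int) (auto simp: finite_up)
  ultimately show ?thesis
    using runs_add[OF fin(1)] runs_add[OF assms(1)] card_up[OF assms(2)] card_shift[of B] by linarith
qed

text \<open>A point of \<open>up B\<close> is the start of a run of \<open>B\<close>, or lies just
  past the end of one, or has both \<open>y\<close> and \<open>y - 1\<close> in
  \<open>B\<close>.\<close>

lemma card_Int_up_le:
  assumes "finite A" "finite B"
  shows "card (A \<inter> up B) \<le> 2 * runs B + card {y \<in> A. y \<in> B \<and> y - 1 \<in> B}"
proof -
  let ?E = "{y. y - 1 \<in> B \<and> y \<notin> B}" and ?S = "{y \<in> B. y - 1 \<notin> B}"
    and ?M = "{y \<in> A. y \<in> B \<and> y - 1 \<in> B}"
  have finE: "finite ?E"
    using finite_subset[OF _ finite_shift[OF assms(2)], of ?E] by auto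
  have "card (A \<inter> up B) \<le> card (?E \<union> ?S \<union> ?M)"
    using assms finE by (intro card_mono) (auto simp: up_def)
  also have "\<dots> \<le> card ?E + card ?S + card ?M"
    using card_Un_le[of "?E \<union> ?S" ?M] card_Un_le[of ?E ?S] by linarith
  also have "\<dots> = 2 * runs B + card ?M"
    using runs_ends[OF assms(2)] by (simp add: runs_def)
  finally show ?thesis .
qed

lemma int_card_eq_sum:
  assumes "finite U" "S \<subseteq> U"
  shows "int (card S) = (\<Sum>y\<in>U. of_bool (y \<in> S))"
  using assms by (simp add: sum.If_cases of_bool_def Int_absorb1)

text \<open>
  The summand for a triangle with \<open>k\<close> corners in the support is $2k - 4\binom{k}{2} + 5\binom{k}{3}$,
  which is $2, 0, -1$ for $k = 1, 2, 3$; together with the number of edges with equal signs it is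
  at most $2$, and at most $0$ when both signs occur. The edges inside a row are
  shared by two levels, which is why \<open>same_sign_pairs\<close> occurs on both sides.
\<close>

lemma row_sign_count:
  fixes a b :: "int \<Rightarrow> real"
  assumes fin: "finite (nz a)" "finite (nz b)"
  defines "A \<equiv> nz a" and "B \<equiv> nz b"
  shows "2 * int (card {y. a y + b (y - 1) + b y \<noteq> 0}) + int (same_sign_pairs a)
    \<ge> 2 * int (card A) + 4 * int (runs B) - 4 * int (card (A \<inter> up B))
      + int (card {y \<in> A. y \<in> B \<and> y - 1 \<in> B})
      + int (card {y \<in> B. y \<in> A \<and> y + 1 \<in> A}) + int (same_sign_pairs b)"
proof -
  let ?T = "{y. a y + b (y - 1) + b y \<noteq> 0}"
  let ?B' = "{y. y - 1 \<in> B}"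
  let ?D1 = "{y. 0 < a y * b (y - 1)}" and ?D2 = "{y. 0 < a y * b y}"
  let ?R = "{y. 0 < b (y - 1) * b y}" and ?RA = "{y. 0 < a (y - 1) * a y}"
  let ?M = "{y \<in> A. y \<in> B \<and> y - 1 \<in> B}" and ?E = "{y \<in> B. y - 1 \<in> B}"
  let ?N = "{y \<in> B. y \<in> A \<and> y + 1 \<in> A}"
  define U where "U = A \<union> B \<union> ?B'"
  have finAB: "finite A" "finite B" using fin by (auto simp: A_def B_def)
  have finU: "finite U" using finAB by (simp add: U_def finite_shift)
  have in_A: "y \<in> A \<longleftrightarrow> a y \<noteq> 0" and in_B: "y \<in> B \<longleftrightarrow> b y \<noteq> 0" for y
    by (auto simp: A_def B_def nz_def)
  have sub: "?T \<subseteq> U" "A \<subseteq> U" "B \<subseteq> U" "?B' \<subseteq> U" "?D1 \<subseteq> U" "?D2 \<subseteq> U" "?R \<subseteq> U"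
    "?M \<subseteq> U" "?E \<subseteq> U" "A \<inter> ?B' \<subseteq> U" "A \<inter> B \<subseteq> U"
    unfolding U_def by (auto simp: in_A in_B)
  \<comment> \<open>The index \<open>y\<close> stands for the triangle with corner values
    \<open>a y\<close>, \<open>b (y - 1)\<close>, \<open>b y\<close>. The estimate is made triangle
    by triangle, over all sign patterns of the corners.\<close>
  have "(\<Sum>y\<in>U. 2 * of_bool (y \<in> A) + 2 * of_bool (y \<in> ?B') + 2 * of_bool (y \<in> B)
        + 5 * of_bool (y \<in> ?M) + of_bool (y \<in> ?D1) + of_bool (y \<in> ?D2) + of_bool (y \<in> ?R) :: int)
    \<le> (\<Sum>y\<in>U. 2 * of_bool (y \<in> ?T) + 4 * of_bool (y \<in> A \<inter> ?B') + 4 * of_bool (y \<in> A \<inter> B)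
        + 4 * of_bool (y \<in> ?E))"
  proof (rule sum_mono)
    fix y assume "y \<in> U"
    have "a y = 0 \<or> a y > 0 \<or> a y < 0" "b y = 0 \<or> b y > 0 \<or> b y < 0"
      "b (y - 1) = 0 \<or> b (y - 1) > 0 \<or> b (y - 1) < 0" by linarith+
    then show "2 * of_bool (y \<in> A) + 2 * of_bool (y \<in> ?B') + 2 * of_bool (y \<in> B)
        + 5 * of_bool (y \<in> ?M) + of_bool (y \<in> ?D1) + of_bool (y \<in> ?D2) + of_bool (y \<in> ?R)
      \<le> (2 * of_bool (y \<in> ?T) + 4 * of_bool (y \<in> A \<inter> ?B') + 4 * of_bool (y \<in> A \<inter> B)
        + 4 * of_bool (y \<in> ?E) :: int)"
      by (elim disjE; cases "a y + b (y - 1) + b y = 0";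
          simp add: in_A in_B zero_less_mult_iff)
  qed
  then have 1: "2 * int (card A) + 2 * int (card ?B') + 2 * int (card B) + 5 * int (card ?M)
      + int (card ?D1) + int (card ?D2) + int (card ?R)
    \<le> 2 * int (card ?T) + 4 * int (card (A \<inter> ?B')) + 4 * int (card (A \<inter> B)) + 4 * int (card ?E)"
    by (simp only: int_card_eq_sum[OF finU] sub sum.distrib sum_distrib_left)
  \<comment> \<open>The cross edges at a point of \<open>A\<close> go to \<open>y - 1\<close> and to
    \<open>y\<close> in \<open>B\<close>; points with both edges are the full triangles
    \<open>?M\<close>.\<close>
  have "A \<inter> up B = (A \<inter> ?B') \<union> (A \<inter> B)" "?M = (A \<inter> ?B') \<inter> (A \<inter> B)" by (auto simp: up_def)
  then have 2: "card (A \<inter> ?B') + card (A \<inter> B) = card (A \<inter> up B) + card ?M"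
    using card_Un_Int[of "A \<inter> ?B'" "A \<inter> B"] finAB by simp
  \<comment> \<open>A full triangle of the other orientation has corner values
    \<open>a (y - 1)\<close>, \<open>a y\<close>, \<open>b (y - 1)\<close>. Two of three nonzero
    signs agree, and the three sets correspond to its three edges.\<close>
  have "{y. y - 1 \<in> ?N} \<subseteq> {y. y - 1 \<in> ?D2} \<union> ?D1 \<union> ?RA"
    by (auto simp: in_A in_B zero_less_mult_iff)
  moreover have "finite ({y. y - 1 \<in> ?D2} \<union> ?D1 \<union> ?RA)"
  proof -
    have "?RA \<subseteq> A" by (auto simp: in_A)
    then show ?thesis
      using finite_subset[OF _ finU] finite_subset[OF _ finAB(1)] sub by (intro finite_UnI finite_shift) auto
  qed
  ultimately have "card {y. y - 1 \<in> ?N} \<le> card ({y. y - 1 \<in> ?D2} \<union> ?D1 \<union> ?RA)"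
    by (intro card_mono)
  also have "\<dots> \<le> card {y. y - 1 \<in> ?D2} + card ?D1 + card ?RA"
    using card_Un_le[of "{y. y - 1 \<in> ?D2} \<union> ?D1" ?RA] card_Un_le[of "{y. y - 1 \<in> ?D2}" ?D1]
    by linarith
  finally have 3: "card ?N \<le> card ?D2 + card ?D1 + card ?RA" unfolding card_shift .
  show ?thesis
    using 1 2 3 runs_add[OF finAB(2)] card_shift[of B] unfolding same_sign_pairs_def by linarith
qed

text \<open>After splitting \<open>card (nz a)\<close> at \<open>up (nz b)\<close>, the term
  \<open>card (nz a \<inter> up (nz b))\<close> remains with coefficient -2. One copy is absorbed by
  \<open>card_Int_up_le\<close>, the other by \<open>runs_strip\<close>, and each uses up one of the
  two triangle counts. The terms with \<open>same_sign_pairs\<close> and with the runs of single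
  rows then telescope in the sweep.\<close>

lemma row_step:
  fixes a b :: "int \<Rightarrow> real"
  assumes "finite (nz a)" "finite (nz b)"
  shows "2 * int (card {y. a y + b (y - 1) + b y \<noteq> 0}) + int (same_sign_pairs a)
    \<ge> 2 * int (card (nz a - up (nz b))) + int (runs (nz b)) - int (runs (nz a))
      + int (runs (nz a \<union> up (nz b))) + int (same_sign_pairs b)"
proof -
  have "card (nz a) = card (nz a - up (nz b)) + card (nz a \<inter> up (nz b))"
    using card_Diff_subset_Int[of "nz a" "up (nz b)"] assms(1)
      card_mono[of "nz a" "nz a \<inter> up (nz b)"] by simp
  then show ?thesis
    using row_sign_count[OF assms] runs_strip[OF assms] card_Int_up_le[OF assms] by linarith
qed

section \<open>Sweeping a connected set of lattice points\<close>

text \<open>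
  The point \<open>(x, y)\<close> stands for the monomial with exponents \<open>x\<close>, \<open>y\<close> and \<open>k - x - y\<close>, where \<open>k\<close> is
  the degree, so two points are adjacent if the monomials differ by a quotient of two variables.
\<close>

definition adjacent :: "int \<times> int \<Rightarrow> int \<times> int \<Rightarrow> bool" where
  "adjacent u v \<longleftrightarrow> (fst v - fst u, snd v - snd u) \<in> {(1,0), (-1,0), (0,1), (0,-1), (1,-1), (-1,1)}"

text \<open>Phrased with neighbour-closed subsets instead of paths, since such a subset is what
  splits the polynomial into two summands.\<close>

definition lattice_connected :: "(int \<times> int) set \<Rightarrow> bool" where
  "lattice_connected K \<longleftrightarrow>
     (\<forall>C. C \<subseteq> K \<longrightarrow> C \<noteq> {} \<longrightarrow> (\<forall>u\<in>C. \<forall>v\<in>K. adjacent u v \<longrightarrow> v \<in> C) \<longrightarrow> C = K)"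

text \<open>A point of row \<open>x'\<close> casts the base, on row \<open>x\<close>, of the
  triangle with that point as apex and sides in the directions (-1,0) and (-1,1).\<close>

definition shadow :: "(int \<times> int) set \<Rightarrow> int \<Rightarrow> int set" where
  "shadow K x = {z. \<exists>x' y. (x', y) \<in> K \<and> x \<le> x' \<and> y \<le> z \<and> z \<le> y + (x' - x)}"

lemma shadow_step: "shadow K (x - 1) = {y. (x - 1, y) \<in> K} \<union> up (shadow K x)"
proof (intro equalityI subsetI)
  fix z assume "z \<in> shadow K (x - 1)"
  then obtain x' y where h: "(x', y) \<in> K" "x - 1 \<le> x'" "y \<le> z" "z \<le> y + (x' - (x - 1))"
    by (auto simp: shadow_def)
  show "z \<in> {y. (x - 1, y) \<in> K} \<union> up (shadow K x)"
  proof (cases "x' = x - 1")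
    case True
    then show ?thesis using h by auto
  next
    case False
    then have "x \<le> x'" using h by simp
    show ?thesis
    proof (cases "z \<le> y + (x' - x)")
      case True
      then have "z \<in> shadow K x" using h \<open>x \<le> x'\<close> unfolding shadow_def by blast
      then show ?thesis by (simp add: up_def)
    next
      case False
      then have "y \<le> z - 1" "z - 1 \<le> y + (x' - x)" using h \<open>x \<le> x'\<close> by auto
      then have "z - 1 \<in> shadow K x"
        using h(1) \<open>x \<le> x'\<close> unfolding shadow_def by blast
      then show ?thesis by (simp add: up_def)
    qed
  qed
next
  fix z assume "z \<in> {y. (x - 1, y) \<in> K} \<union> up (shadow K x)"
  then consider "(x - 1, z) \<in> K"
    | x' y where "(x', y) \<in> K" "x \<le> x'" "y \<le> z" "z \<le> y + (x' - (x - 1))"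
    by (force simp: up_def shadow_def)
  then show "z \<in> shadow K (x - 1)"
  proof cases
    case 1
    then show ?thesis unfolding shadow_def by force
  next
    case 2
    then have "x - 1 \<le> x'" by simp
    then show ?thesis using 2 unfolding shadow_def by blast
  qed
qed

lemma finite_shadow:
  assumes "finite K"
  shows "finite (shadow K x)"
proof -
  have "shadow K x \<subseteq> (\<Union>(x', y)\<in>K. {y..y + (x' - x)})"
    by (fastforce simp: shadow_def)
  then show ?thesis using assms by (auto intro: finite_subset)
qed

text \<open>Points of \<open>K\<close> in rows at or beyond \<open>x\<close> have their second
  coordinate in the shadow, and it changes by at most 1 between neighbours. So a neighbour stays
  over the run that starts at \<open>y0\<close>.\<close>

lemma shadow_run_closed:
  assumes "y0 - 1 \<notin> shadow K x"
  defines "C \<equiv> {u \<in> K. x \<le> fst u \<and> y0 \<le> snd u \<and> {y0..snd u} \<subseteq> shadow K x}"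
  assumes "u \<in> C" "v \<in> K" "adjacent u v" "x \<le> fst v"
  shows "v \<in> C"
proof -
  obtain x1 y1 x2 y2 where uv: "u = (x1, y1)" "v = (x2, y2)" by (cases u, cases v)
  have u: "(x1, y1) \<in> K" "x \<le> x1" "y0 \<le> y1" "{y0..y1} \<subseteq> shadow K x"
    using assms(3) uv by (auto simp: C_def)
  have v: "x \<le> x2" "(x2, y2) \<in> K" using assms uv by auto
  then have y2: "y2 \<in> shadow K x" unfolding shadow_def by force
  have near: "y2 = y1 - 1 \<or> y2 = y1 \<or> y2 = y1 + 1" using assms(5) uv by (auto simp: adjacent_def)
  have "y0 \<le> y2" using near y2 assms(1) u(3) by (cases "y2 = y0 - 1") auto
  moreover have "{y0..y2} \<subseteq> {y0..y1} \<union> {y2}" using near by auto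
  ultimately show ?thesis using u y2 v uv by (auto simp: C_def)
qed

text \<open>Otherwise the points of \<open>K\<close> over this run all lie strictly beyond row
  \<open>x\<close>, so their neighbours are still in rows at or beyond \<open>x\<close>. They would
  form a closed set, hence all of \<open>K\<close>, which contradicts the point in row
  \<open>x0\<close>.\<close>

lemma shadow_run_meets_row:
  assumes conn: "lattice_connected K" and low: "(x0, w) \<in> K" "x0 \<le> x"
    and y0: "y0 \<in> shadow K x" "y0 - 1 \<notin> shadow K x"
  shows "\<exists>v\<in>{y. (x, y) \<in> K}. y0 \<le> v \<and> {y0..v} \<subseteq> shadow K x"
proof (rule ccontr)
  assume no: "\<not> ?thesis"
  define C where "C = {u \<in> K. x \<le> fst u \<and> y0 \<le> snd u \<and> {y0..snd u} \<subseteq> shadow K x}"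
  have off: "x < fst u" if "u \<in> C" for u
  proof (rule ccontr)
    assume "\<not> x < fst u"
    then have "fst u = x" using that by (simp add: C_def)
    then have "(x, snd u) \<in> K" using that by (auto simp: C_def)
    then show False using no that by (auto simp: C_def)
  qed
  obtain x' y where "(x', y) \<in> K" "x \<le> x'" "y \<le> y0" "y0 \<le> y + (x' - x)"
    using y0(1) by (auto simp: shadow_def)
  \<comment> \<open>The start of a run is the lower end of some base segment, as the segment would
    otherwise contain \<open>y0 - 1\<close> too.\<close>
  moreover from this have "y = y0"
  proof -
    have "y0 - 1 \<in> shadow K x" if "y < y0"
      unfolding shadow_def using that calculation by force
    then show ?thesis using y0(2) \<open>y \<le> y0\<close> by fastforce
  qed
  ultimately have "(x', y) \<in> C" using y0(1) by (auto simp: C_def)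
  then have "C \<noteq> {}" by auto
  moreover have "v \<in> C" if "u \<in> C" "v \<in> K" "adjacent u v" for u v
  proof -
    have "x \<le> fst v" using off[OF that(1)] that(3) by (auto simp: adjacent_def)
    then show ?thesis using shadow_run_closed[OF y0(2)] that unfolding C_def by blast
  qed
  moreover have "C \<subseteq> K" by (auto simp: C_def)
  ultimately have "C = K" using conn unfolding lattice_connected_def by blast
  then show False using off low by force
qed

text \<open>By connectedness all of \<open>K\<close> lies over the lowest run of the shadow on its
  last row. That run starts at or below \<open>y1\<close> and, through the base cast by
  \<open>(x2, y2)\<close>, reaches \<open>y2 + (x2 - x0)\<close>.\<close>

lemma card_shadow_ge:
  assumes conn: "lattice_connected K" and fin: "finite K"
    and low: "\<And>u. u \<in> K \<Longrightarrow> x0 \<le> fst u"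
    and u: "(x1, y1) \<in> K" and v: "(x2, y2) \<in> K"
  shows "int (card (shadow K x0)) \<ge> x2 + y2 - x0 - y1 + 1"
proof -
  define y0 where "y0 = Min (shadow K x0)"
  have y1: "y1 \<in> shadow K x0" unfolding shadow_def using u low[OF u] by force
  have finS: "finite (shadow K x0)" by (rule finite_shadow[OF fin])
  have y0: "y0 \<in> shadow K x0" unfolding y0_def using y1 finS by (intro Min_in) auto
  have le: "y0 \<le> z" if "z \<in> shadow K x0" for z
    unfolding y0_def using that finS by simp
  have y0': "y0 - 1 \<notin> shadow K x0" using le[of "y0 - 1"] by auto
  define C where "C = {u \<in> K. x0 \<le> fst u \<and> y0 \<le> snd u \<and> {y0..snd u} \<subseteq> shadow K x0}"
  obtain x' y where xy: "(x', y) \<in> K" "x0 \<le> x'" "y \<le> y0" "y0 \<le> y + (x' - x0)"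
    using y0 by (auto simp: shadow_def)
  have "y \<in> shadow K x0" unfolding shadow_def using xy by force
  then have "y = y0" using le xy by force
  then have "(x', y) \<in> C" using y0 xy by (auto simp: C_def)
  then have "C \<noteq> {}" by auto
  moreover have "v \<in> C" if "u \<in> C" "v \<in> K" "adjacent u v" for u v
    using shadow_run_closed[OF y0'] that low[OF that(2)] unfolding C_def by blast
  moreover have "C \<subseteq> K" by (auto simp: C_def)
  ultimately have "C = K" using conn unfolding lattice_connected_def by blast
  then have "(x2, y2) \<in> C" using v by simp
  then have "{y0..y2} \<subseteq> shadow K x0" by (simp add: C_def)
  moreover have "{y2..y2 + (x2 - x0)} \<subseteq> shadow K x0"
    unfolding shadow_def using v low[OF v] by force
  ultimately have "{y0..y2 + (x2 - x0)} \<subseteq> shadow K x0" by force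
  then have "card {y0..y2 + (x2 - x0)} \<le> card (shadow K x0)" by (intro card_mono finS)
  then show ?thesis using le[OF y1] by auto
qed

text \<open>Multiplication by $S$ on coefficients, after setting $X_2 = 1$.\<close>

definition times_S :: "(int \<Rightarrow> int \<Rightarrow> real) \<Rightarrow> int \<Rightarrow> int \<Rightarrow> real" where
  "times_S q x y = q (x - 1) y + q x (y - 1) + q x y"

definition supp2 :: "(int \<Rightarrow> int \<Rightarrow> real) \<Rightarrow> (int \<times> int) set" where
  "supp2 q = {(x, y). q x y \<noteq> 0}"

text \<open>Row \<open>x\<close> of the product involves rows \<open>x - 1\<close> and
  \<open>x\<close> of \<open>q\<close>. Each induction step thus completes one row of the product
  and lets one new row of \<open>q\<close> into the shadow.\<close>

lemma sweep:
  fixes q :: "int \<Rightarrow> int \<Rightarrow> real"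
  assumes fin: "finite (supp2 q)" and conn: "lattice_connected (supp2 q)"
    and low: "(x0, w) \<in> supp2 q" and top: "\<And>u. u \<in> supp2 q \<Longrightarrow> fst u < X"
    and x: "x0 \<le> X - int n"
  shows "(\<Sum>x\<in>{X - int n<..X}. 2 * int (card {y. times_S q x y \<noteq> 0})) + int (same_sign_pairs (q (X - int n)))
    \<ge> int (card (shadow (supp2 q) (X - int n))) + 2 * int (runs (shadow (supp2 q) (X - int n)))
      - int (runs (nz (q (X - int n))))"
  using x
proof (induction n)
  case 0
  have "shadow (supp2 q) X = {}" using top by (fastforce simp: shadow_def)
  then show ?case by (simp add: runs_def)
next
  case (Suc n)
  define x where "x = X - int n"
  let ?K = "supp2 q"
  let ?A = "nz (q (x - 1))" and ?B = "nz (q x)" and ?S = "shadow ?K x" and ?S' = "shadow ?K (x - 1)"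
  have row: "nz (q z) = {y. (z, y) \<in> ?K}" for z by (auto simp: nz_def supp2_def)
  have finrow: "finite (nz (q z))" for z
    unfolding row using finite_imageI[OF fin, of snd] by (rule finite_subset[rotated]) force
  have finS: "finite ?S" by (rule finite_shadow[OF fin])
  have S': "?S' = ?A \<union> up ?S" unfolding shadow_step row ..
  have "?B \<subseteq> ?S" unfolding row shadow_def by force
  then have BS: "up ?B \<subseteq> up ?S" by (auto simp: up_def)
  have S'_eq: "?S' = up ?S \<union> (?A - up ?S)" unfolding S' by auto
  have new: "card (?A - up ?S) \<le> card (?A - up ?B)"
    using BS finrow by (intro card_mono) auto
  have "card ?S' \<le> card (up ?S) + card (?A - up ?S)"
    unfolding S'_eq by (rule card_Un_le)
  then have 1: "card ?S' \<le> card ?S + runs ?S + card (?A - up ?B)"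
    using new card_up[OF finS] by linarith
  have 2: "runs ?S' \<le> runs ?S + card (?A - up ?B)"
    using runs_Un_le[of "up ?S" "?A - up ?S"] finite_up[OF finS] finrow[of "x - 1"]
      runs_up_le[OF finS] new unfolding S'_eq by simp
  \<comment> \<open>Every run of the new shadow meets row \<open>x - 1\<close> of the support,
    because the support still has a point in row \<open>x0\<close>. This controls the second copy of
    \<open>runs ?S'\<close> in the invariant; \<open>2\<close> controls the first.\<close>
  have 3: "runs ?S' \<le> runs (?A \<union> up ?B)"
  proof (rule runs_le_if_meets)
    show "finite (?A \<union> up ?B)" using finrow by (simp add: finite_up)
    show "?A \<union> up ?B \<subseteq> ?S'" using BS S' by auto
    fix y assume "y \<in> ?S'" "y - 1 \<notin> ?S'"
    then show "\<exists>v\<in>?A \<union> up ?B. y \<le> v \<and> {y..v} \<subseteq> ?S'"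
      using shadow_run_meets_row[OF conn low, of "x - 1" y] Suc.prems unfolding row x_def
      by (auto simp: algebra_simps)
  qed
  have 4: "2 * int (card {y. times_S q x y \<noteq> 0}) + int (same_sign_pairs (q (x - 1)))
    \<ge> 2 * int (card (?A - up ?B)) + int (runs ?B) - int (runs ?A)
      + int (runs (?A \<union> up ?B)) + int (same_sign_pairs (q x))"
    unfolding times_S_def by (rule row_step[OF finrow finrow])
  have 5: "{x - 1<..X} = insert x {x<..X}" by (auto simp: x_def)
  have "(\<Sum>x\<in>{x<..X}. 2 * int (card {y. times_S q x y \<noteq> 0})) + int (same_sign_pairs (q x))
    \<ge> int (card ?S) + 2 * int (runs ?S) - int (runs ?B)"
    using Suc.IH Suc.prems by (simp add: x_def)
  then have "(\<Sum>x\<in>{x - 1<..X}. 2 * int (card {y. times_S q x y \<noteq> 0})) + int (same_sign_pairs (q (x - 1)))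
    \<ge> int (card ?S') + 2 * int (runs ?S') - int (runs ?A)"
    using 1 2 3 4 unfolding 5 by simp
  moreover have "X - int (Suc n) = x - 1" by (simp add: x_def)
  ultimately show ?case by metis
qed

section \<open>Lower bound for the number of monomials of the product\<close>

lemma finite_supp2_times_S:
  assumes "finite (supp2 q)"
  shows "finite (supp2 (times_S q))"
proof -
  have "supp2 (times_S q) \<subseteq> supp2 q \<union> (\<lambda>(x, y). (x + 1, y)) ` supp2 q \<union> (\<lambda>(x, y). (x, y + 1)) ` supp2 q"
  proof
    fix u assume "u \<in> supp2 (times_S q)"
    then obtain x y where u: "u = (x, y)" "q (x - 1) y \<noteq> 0 \<or> q x (y - 1) \<noteq> 0 \<or> q x y \<noteq> 0"
      by (auto simp: supp2_def times_S_def)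
    have "u = (\<lambda>(x, y). (x + 1, y)) (x - 1, y)" "u = (\<lambda>(x, y). (x, y + 1)) (x, y - 1)"
      using u by auto
    then show "u \<in> supp2 q \<union> (\<lambda>(x, y). (x + 1, y)) ` supp2 q \<union> (\<lambda>(x, y). (x, y + 1)) ` supp2 q"
      using u by (auto simp: supp2_def image_iff)
  qed
  then show ?thesis using assms by (auto intro: finite_subset)
qed

lemma card_supp2_times_S_ge:
  fixes q :: "int \<Rightarrow> int \<Rightarrow> real"
  assumes fin: "finite (supp2 q)" and conn: "lattice_connected (supp2 q)"
    and u: "(x0, w) \<in> supp2 q" "\<And>u. u \<in> supp2 q \<Longrightarrow> x0 \<le> fst u"
    and v: "(x1, y1) \<in> supp2 q" and z: "(x2, y2) \<in> supp2 q"
  shows "2 * int (card (supp2 (times_S q))) \<ge> x2 + y2 - x0 - y1 + 6"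
proof -
  let ?K = "supp2 q"
  let ?T = "\<lambda>x. {y. times_S q x y \<noteq> 0}"
  \<comment> \<open>One beyond the largest row of the support, since multiplication by
    \<open>S\<close> shifts rows by up to 1.\<close>
  define X where "X = Max (fst ` ?K) + 1"
  have top: "fst u < X" if "u \<in> ?K" for u
    using Max_ge[of "fst ` ?K" "fst u"] fin that by (simp add: X_def)
  define n where "n = nat (X - x0)"
  have n: "X - int n = x0" "x0 \<le> X" using top[OF u(1)] by (auto simp: n_def)
  have row: "nz (q z) = {y. (z, y) \<in> ?K}" for z by (auto simp: nz_def supp2_def)
  have finrow: "finite (nz (q z))" for z
    unfolding row using finite_imageI[OF fin, of snd] by (rule finite_subset[rotated]) force
  have 1: "(\<Sum>x\<in>{x0<..X}. 2 * int (card (?T x))) + int (same_sign_pairs (q x0))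
    \<ge> int (card (shadow ?K x0)) + 2 * int (runs (shadow ?K x0)) - int (runs (nz (q x0)))"
    using sweep[OF fin conn u(1) top, of n] n by simp
  have q0: "q (x0 - 1) = (\<lambda>_. 0)"
    using u(2) by (fastforce simp: supp2_def)
  \<comment> \<open>The last row is counted with a zero row below it. Added to \<open>1\<close>,
    this cancels \<open>same_sign_pairs\<close> and leaves the shadow size, two times its runs and
    three times the runs of row \<open>x0\<close>, hence at least 5 more than the shadow
    size.\<close>
  have 2: "2 * int (card (?T x0)) \<ge> 4 * int (runs (nz (q x0))) + int (same_sign_pairs (q x0))"
    using row_sign_count[of "q (x0 - 1)" "q x0"] finrow
    by (simp add: times_S_def q0 nz_def same_sign_pairs_def)
  have pos: "runs U \<ge> 1" if "finite U" "y \<in> U" for U y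
  proof -
    have "Min U - 1 \<notin> U" using Min_le[OF that(1), of "Min U - 1"] by auto
    then have "Min U \<in> {y \<in> U. y - 1 \<notin> U}" using Min_in[OF that(1)] that(2) by auto
    then have "{y \<in> U. y - 1 \<notin> U} \<noteq> {}" by blast
    then show ?thesis unfolding runs_def using that(1) by (simp add: Suc_le_eq card_gt_0_iff)
  qed
  have "w \<in> nz (q x0)" using u by (simp add: row)
  moreover have "w \<in> shadow ?K x0" using u(1) unfolding shadow_def by force
  ultimately have 3: "runs (nz (q x0)) \<ge> 1" "runs (shadow ?K x0) \<ge> 1"
    using pos finrow finite_shadow[OF fin] by blast+
  have "{x0..X} = insert x0 {x0<..X}" using n by auto
  then have 4: "(\<Sum>x\<in>{x0..X}. int (card (?T x))) = int (card (?T x0)) + (\<Sum>x\<in>{x0<..X}. int (card (?T x)))"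
    by simp
  have finT: "finite (?T x)" for x
    using finite_imageI[OF finite_supp2_times_S[OF fin], of snd]
    by (rule finite_subset[rotated]) (force simp: supp2_def)
  have "card (Sigma {x0..X} ?T) \<le> card (supp2 (times_S q))"
    using finite_supp2_times_S[OF fin] by (intro card_mono) (auto simp: supp2_def)
  then have 5: "(\<Sum>x\<in>{x0..X}. int (card (?T x))) \<le> int (card (supp2 (times_S q)))"
    using finT by (simp add: card_SigmaI flip: of_nat_sum)
  show ?thesis
    using 1 2 3 4 5 card_shadow_ge[OF conn fin u(2) v z] by (simp flip: sum_distrib_left)
qed

section \<open>The quotient by $S$\<close>

text \<open>Summation by parts: multiplication by \<open>S\<close> is moved from the coefficients to
  the weight \<open>w\<close>, which later is the value of a monomial.\<close>

lemma sum_times_S: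
  fixes w :: "int \<Rightarrow> int \<Rightarrow> real"
  assumes finq: "finite (supp2 q)" and finU: "finite U" "supp2 (times_S q) \<subseteq> U"
  shows "(\<Sum>(x, y)\<in>U. times_S q x y * w x y)
    = (\<Sum>(x, y)\<in>supp2 q. q x y * (w (x + 1) y + w x (y + 1) + w x y))"
proof -
  let ?K = "supp2 q"
  define V where "V = U \<union> ?K \<union> (\<lambda>(x, y). (x + 1, y)) ` ?K \<union> (\<lambda>(x, y). (x, y + 1)) ` ?K"
  have finV: "finite V" using assms by (simp add: V_def)
  have K: "(x, y) \<in> ?K \<longleftrightarrow> q x y \<noteq> 0" for x y by (simp add: supp2_def)
  have V: "(x, y) \<in> V" "(x + 1, y) \<in> V" "(x, y + 1) \<in> V" if "q x y \<noteq> 0" for x y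
    using that K[of x y] unfolding V_def by force+
  have "(\<Sum>(x, y)\<in>U. times_S q x y * w x y) = (\<Sum>(x, y)\<in>V. times_S q x y * w x y)"
  proof (rule sum.mono_neutral_left[OF finV])
    show "U \<subseteq> V" by (auto simp: V_def)
    show "\<forall>u\<in>V - U. (case u of (x, y) \<Rightarrow> times_S q x y * w x y) = 0"
    proof
      fix u assume "u \<in> V - U"
      then have "u \<notin> supp2 (times_S q)" using finU(2) by blast
      then show "(case u of (x, y) \<Rightarrow> times_S q x y * w x y) = 0" by (cases u) (simp add: supp2_def)
    qed
  qed
  also have "\<dots> = (\<Sum>(x, y)\<in>V. q (x - 1) y * w x y) + (\<Sum>(x, y)\<in>V. q x (y - 1) * w x y)
      + (\<Sum>(x, y)\<in>V. q x y * w x y)"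
    by (simp add: times_S_def case_prod_beta sum.distrib[symmetric] algebra_simps)
  also have "(\<Sum>(x, y)\<in>V. q (x - 1) y * w x y) = (\<Sum>(x, y)\<in>?K. q x y * w (x + 1) y)"
    by (rule sum.reindex_bij_witness_not_neutral[where S' = "{u \<in> V. q (fst u - 1) (snd u) = 0}"
          and T' = "{}" and i = "\<lambda>(x, y). (x + 1, y)" and j = "\<lambda>(x, y). (x - 1, y)"])
       (use finV V K in auto)
  also have "(\<Sum>(x, y)\<in>V. q x (y - 1) * w x y) = (\<Sum>(x, y)\<in>?K. q x y * w x (y + 1))"
    by (rule sum.reindex_bij_witness_not_neutral[where S' = "{u \<in> V. q (fst u) (snd u - 1) = 0}"
          and T' = "{}" and i = "\<lambda>(x, y). (x, y + 1)" and j = "\<lambda>(x, y). (x, y - 1)"])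
       (use finV V K in auto)
  also have "(\<Sum>(x, y)\<in>V. q x y * w x y) = (\<Sum>(x, y)\<in>?K. q x y * w x y)"
    using V by (intro sum.mono_neutral_right finV) (auto simp: K)
  finally show ?thesis
    by (simp add: case_prod_beta sum.distrib[symmetric] algebra_simps)
qed

lemma times_S_nonzero:
  assumes "finite (supp2 q)" "supp2 q \<noteq> {}"
  shows "supp2 (times_S q) \<noteq> {}"
proof -
  have "Max (fst ` supp2 q) \<in> fst ` supp2 q" using assms by (intro Max_in) auto
  then obtain x y where xy: "(x, y) \<in> supp2 q" "x = Max (fst ` supp2 q)" by auto
  have "q (x + 1) z = 0" for z
  proof (rule ccontr)
    assume "q (x + 1) z \<noteq> 0"
    then have "x + 1 \<in> fst ` supp2 q" by (force simp: supp2_def)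
    then have "x + 1 \<le> x" using assms(1) Max_ge[of "fst ` supp2 q" "x + 1"] xy(2) by simp
    then show False by simp
  qed
  then have "(x + 1, y) \<in> supp2 (times_S q)" using xy(1) by (simp add: supp2_def times_S_def)
  then show ?thesis by blast
qed

text \<open>Among the support points of degree at least \<open>D\<close>, one with largest first
  exponent cannot be cancelled after multiplication by $X_0$, and it yields a product term of degree
  above \<open>D\<close>.\<close>

lemma quotient_degree_le:
  assumes fin: "finite (supp2 q)" and deg: "\<And>x y. (x, y) \<in> supp2 (times_S q) \<Longrightarrow> x + y \<le> D"
    and "(x, y) \<in> supp2 q"
  shows "x + y + 1 \<le> D"
proof (rule ccontr)
  assume big: "\<not> x + y + 1 \<le> D"
  define H where "H = {(x, y) \<in> supp2 q. D \<le> x + y}"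
  have H: "(x, y) \<in> H" using assms(3) big by (simp add: H_def)
  have finH: "finite H" unfolding H_def using fin by (rule finite_subset[rotated]) auto
  have "Max (fst ` H) \<in> fst ` H" using finH H by (intro Max_in) auto
  then obtain x1 y1 where m: "(x1, y1) \<in> H" "x1 = Max (fst ` H)" by auto
  have up: "x1 + 1 \<notin> fst ` H" using finH m(2) Max_ge[of "fst ` H" "x1 + 1"] by auto
  have "q (x1 + 1) z = 0" if "D \<le> x1 + 1 + z" for z
    using that up by (force simp: H_def supp2_def)
  then have "times_S q (x1 + 1) y1 = q x1 y1" using m(1) by (simp add: times_S_def H_def)
  then have "(x1 + 1, y1) \<in> supp2 (times_S q)" using m(1) by (simp add: supp2_def H_def)
  then show False using deg m(1) by (force simp: H_def)
qed

section \<open>Passing between homogeneous polynomials and lattice coefficients\<close>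

lemma sum_atMost_2: "(\<Sum>i\<le>2::nat. f i) = f 0 + f 1 + (f 2 :: 'a::comm_monoid_add)"
  by (simp add: numeral_2_eq_2)

lemma prod_atMost_2: "(\<Prod>i\<le>2::nat. f i) = f 0 * f 1 * (f 2 :: 'a::comm_monoid_mult)"
  by (simp add: numeral_2_eq_2)

lemma mono_2_eqI:
  assumes "is_mono 2 a" "is_mono 2 b" "a 0 = b 0" "a 1 = b 1" "tdeg 2 a = tdeg 2 b"
  shows "a = b"
proof
  fix i :: nat
  consider "i = 0" | "i = 1" | "i = 2" | "i > 2" by linarith
  then show "a i = b i"
    using assms by cases (auto simp: is_mono_def tdeg_def sum_atMost_2)
qed

lemma I_set_2_quotient:
  assumes P: "P \<in> I_set 2" and D: "\<And>a. a \<in> supp P \<Longrightarrow> tdeg 2 a = D"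
  obtains q where "finite (supp2 q)" "\<And>x y. (x, y) \<in> supp2 q \<Longrightarrow> 0 \<le> x \<and> 0 \<le> y"
    "\<And>a. a \<in> supp P \<Longrightarrow> times_S q (int (a 0)) (int (a 1)) = P a"
    "supp2 (times_S q) = (\<lambda>a. (int (a 0), int (a 1))) ` supp P"
proof -
  have fin: "finite (supp P)" and mono: "\<And>a. a \<in> supp P \<Longrightarrow> is_mono 2 a"
    and van: "\<And>x. (\<Sum>i\<le>2. x i) = 0 \<Longrightarrow> eval 2 P x = 0"
    using P by (auto simp: I_set_def is_poly_def)
  define p :: "real poly poly" where "p = (\<Sum>a\<in>supp P. monom (monom (P a) (a 0)) (a 1))"
  \<comment> \<open>The inner variable is $X_0$, the outer one $X_1$, so $S = 0$ means $X_1 = -1 - X_0$.\<close>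
  have "poly (poly p [:-1, -1:]) t = 0" for t
  proof -
    have "poly (poly p [:-1, -1:]) t = eval 2 P (\<lambda>i. if i = 0 then t else if i = 1 then - 1 - t else 1)"
      unfolding p_def eval_def poly_sum
      by (simp add: poly_monom prod_atMost_2 poly_sum mult.assoc)
    also have "\<dots> = 0" by (rule van) (simp add: sum_atMost_2)
    finally show ?thesis .
  qed
  \<comment> \<open>A real polynomial with only zero values is zero; the factor theorem over the
    ring of polynomials in $X_0$ then splits off $1 + X_0 + X_1$.\<close>
  then have "poly p [:-1, -1:] = 0" by (metis poly_all_0_iff_0)
  then obtain Q where Q: "p = [:- [:-1, -1:], 1:] * Q" by (auto simp: poly_eq_0_iff_dvd)
  \<comment> \<open>Extension by zero to negative exponents lets \<open>times_S\<close> reproduce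
    the boundary cases of \<open>coeff_p\<close>.\<close>
  define q :: "int \<Rightarrow> int \<Rightarrow> real"
    where "q x y = (if x < 0 \<or> y < 0 then 0 else coeff (coeff Q (nat y)) (nat x))" for x y
  have coeff_p: "coeff (coeff p j) i = (if j = 0 then 0 else coeff (coeff Q (j - 1)) i)
      + (if i = 0 then 0 else coeff (coeff Q j) (i - 1)) + coeff (coeff Q j) i" for i j
    unfolding Q by (simp add: coeff_pCons split: nat.split)
  have times: "times_S q x y = (if x < 0 \<or> y < 0 then 0 else coeff (coeff p (nat y)) (nat x))" for x y
    unfolding times_S_def q_def coeff_p by (auto simp: nat_diff_distrib)
  have coeff_p_sum: "coeff (coeff p j) i = (\<Sum>a\<in>supp P. if a 1 = j \<and> a 0 = i then P a else 0)" for i j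
    unfolding p_def coeff_sum by (intro sum.cong) auto
  have at: "times_S q (int (a 0)) (int (a 1)) = P a" if "a \<in> supp P" for a
  proof -
    have "(\<Sum>b\<in>supp P. if b 1 = a 1 \<and> b 0 = a 0 then P b else 0) = (\<Sum>b\<in>supp P. if b = a then P b else 0)"
      using mono_2_eqI[OF mono mono] D that by (intro sum.cong) auto
    then show ?thesis unfolding times coeff_p_sum using fin that by simp
  qed
  show ?thesis
  proof
    have "supp2 q \<subseteq> (\<Union>j\<le>degree Q. \<Union>i\<le>degree (coeff Q j). {(int i, int j)})"
    proof
      fix u assume "u \<in> supp2 q"
      then obtain x y where u: "u = (x, y)" "0 \<le> x" "0 \<le> y" "coeff (coeff Q (nat y)) (nat x) \<noteq> 0"
        by (auto simp: supp2_def q_def split: if_splits)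
      then have "nat x \<le> degree (coeff Q (nat y))" by (intro le_degree)
      moreover have "nat y \<le> degree Q" using u(4) by (intro le_degree) auto
      ultimately show "u \<in> (\<Union>j\<le>degree Q. \<Union>i\<le>degree (coeff Q j). {(int i, int j)})"
        using u by (intro UN_I[of "nat y"] UN_I[of "nat x"]) auto
    qed
    then show "finite (supp2 q)" by (rule finite_subset) auto
    show "0 \<le> x \<and> 0 \<le> y" if "(x, y) \<in> supp2 q" for x y
      using that by (auto simp: supp2_def q_def split: if_splits)
    show "times_S q (int (a 0)) (int (a 1)) = P a" if "a \<in> supp P" for a by (rule at[OF that])
    show "supp2 (times_S q) = (\<lambda>a. (int (a 0), int (a 1))) ` supp P"
    proof (intro equalityI subsetI)
      fix u assume "u \<in> supp2 (times_S q)"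
      then obtain x y where u: "u = (x, y)" "0 \<le> x" "0 \<le> y" "coeff (coeff p (nat y)) (nat x) \<noteq> 0"
        by (auto simp: supp2_def times split: if_splits)
      obtain a where "a \<in> supp P" "(if a 1 = nat y \<and> a 0 = nat x then P a else 0) \<noteq> 0"
        using u(4) unfolding coeff_p_sum by (rule sum.not_neutral_contains_not_neutral)
      then have "a \<in> supp P" "a 1 = nat y" "a 0 = nat x" by (auto split: if_splits)
      then show "u \<in> (\<lambda>a. (int (a 0), int (a 1))) ` supp P" using u by force
    next
      fix u assume "u \<in> (\<lambda>a. (int (a 0), int (a 1))) ` supp P"
      then show "u \<in> supp2 (times_S q)" using at by (auto simp: supp2_def supp_def)
    qed
  qed
qed

lemma times_S_in_I_set:
  assumes fin: "finite A" and A: "\<And>a. a \<in> A \<Longrightarrow> is_mono 2 a \<and> tdeg 2 a = D"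
    and q: "finite (supp2 q)" "\<And>x y. (x, y) \<in> supp2 q \<Longrightarrow> 0 \<le> x \<and> 0 \<le> y \<and> x + y + 1 \<le> int D"
    and supp: "supp2 (times_S q) \<subseteq> (\<lambda>a. (int (a 0), int (a 1))) ` A"
  shows "(\<lambda>a. if a \<in> A then times_S q (int (a 0)) (int (a 1)) else 0) \<in> I_set 2" (is "?P \<in> _")
proof -
  let ?l = "\<lambda>a::nat \<Rightarrow> nat. (int (a 0), int (a 1))"
  have sub: "supp ?P \<subseteq> A" by (auto simp: supp_def)
  have inj: "inj_on ?l A"
    using A by (intro inj_onI mono_2_eqI) auto
  have "eval 2 ?P t = 0" if t: "(\<Sum>i\<le>2. t i) = 0" for t :: "nat \<Rightarrow> real"
  proof -
    \<comment> \<open>The exponent of $X_2$ is restored from the degree \<open>D\<close>. The bound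
      \<open>x + y + 1 \<le> int D\<close> keeps \<open>nat\<close> from truncating, so the three
      shifted weights share the factor $S$.\<close>
    define w where "w x y = t 0 ^ nat x * t 1 ^ nat y * t 2 ^ nat (int D - x - y)" for x y
    have w: "w (int (a 0)) (int (a 1)) = (\<Prod>i\<le>2. t i ^ a i)" if "a \<in> A" for a
    proof -
      have "nat (int D - int (a 0) - int (a 1)) = a 2"
        using A[OF that] by (auto simp: tdeg_def sum_atMost_2)
      then show ?thesis by (simp add: w_def prod_atMost_2)
    qed
    have "eval 2 ?P t = (\<Sum>a\<in>A. ?P a * (\<Prod>i\<le>2. t i ^ a i))"
      unfolding eval_def using sub fin by (intro sum.mono_neutral_left) (auto simp: supp_def)
    also have "\<dots> = (\<Sum>a\<in>A. (case ?l a of (x, y) \<Rightarrow> times_S q x y * w x y))"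
      by (intro sum.cong refl) (simp only: w prod.case if_True)
    also have "\<dots> = (\<Sum>(x, y)\<in>?l ` A. times_S q x y * w x y)"
      using sum.reindex[OF inj, of "\<lambda>(x, y). times_S q x y * w x y"] by simp
    also have "\<dots> = (\<Sum>(x, y)\<in>supp2 q. q x y * (w (x + 1) y + w x (y + 1) + w x y))"
      using fin by (intro sum_times_S q supp) auto
    also have "\<dots> = 0"
    proof (rule sum.neutral, clarify)
      fix x y assume "(x, y) \<in> supp2 q"
      then have xy: "0 \<le> x" "0 \<le> y" "x + y + 1 \<le> int D" using q by auto
      define k where "k = nat (int D - x - y - 1)"
      have e: "nat (int D - (x + 1) - y) = k" "nat (int D - x - (y + 1)) = k"
        "nat (int D - x - y) = Suc k" "nat (x + 1) = Suc (nat x)" "nat (y + 1) = Suc (nat y)"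
        using xy by (auto simp: k_def)
      have "w (x + 1) y + w x (y + 1) + w x y
          = t 0 ^ nat x * t 1 ^ nat y * t 2 ^ k * (t 0 + t 1 + t 2)"
        unfolding w_def e by (simp add: algebra_simps)
      then show "q x y * (w (x + 1) y + w x (y + 1) + w x y) = 0"
        using t by (simp add: sum_atMost_2)
    qed
    finally show ?thesis .
  qed
  moreover have "homogeneous 2 ?P" unfolding homogeneous_def using sub A by blast
  moreover have "is_poly 2 ?P" unfolding is_poly_def using sub A fin finite_subset by blast
  ultimately show ?thesis by (simp add: I_set_def)
qed

text \<open>A proper nonempty closed part \<open>C\<close> splits \<open>q\<close> in two. Any two
  corners of a triangle are adjacent, so no triangle meets both parts; their products with $S$ have
  disjoint supports and decompose \<open>P\<close>.\<close>

lemma lattice_connected_quotient: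
  assumes ind: "indecomposable 2 P" and D: "\<And>a. a \<in> supp P \<Longrightarrow> tdeg 2 a = D"
    and fin: "finite (supp2 q)" and pos: "\<And>x y. (x, y) \<in> supp2 q \<Longrightarrow> 0 \<le> x \<and> 0 \<le> y"
    and at: "\<And>a. a \<in> supp P \<Longrightarrow> times_S q (int (a 0)) (int (a 1)) = P a"
    and supp: "supp2 (times_S q) = (\<lambda>a. (int (a 0), int (a 1))) ` supp P"
  shows "lattice_connected (supp2 q)"
  unfolding lattice_connected_def
proof (intro allI impI, rule ccontr)
  fix C assume C: "C \<subseteq> supp2 q" "C \<noteq> {}" "\<forall>u\<in>C. \<forall>v\<in>supp2 q. adjacent u v \<longrightarrow> v \<in> C" "C \<noteq> supp2 q"
  have P: "P \<in> I_set 2" using ind by (simp add: indecomposable_def)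
  have finP: "finite (supp P)" and mono: "\<And>a. a \<in> supp P \<Longrightarrow> is_mono 2 a"
    using P by (auto simp: I_set_def is_poly_def)
  define r where "r E x y = (if (x, y) \<in> E then q x y else 0)" for E x y
  define F where "F E a = (if a \<in> supp P then times_S (r E) (int (a 0)) (int (a 1)) else 0)"
    for E and a :: "nat \<Rightarrow> nat"
  let ?C' = "supp2 q - C"
  have suppr: "supp2 (r E) = E" if "E \<subseteq> supp2 q" for E
    using that by (auto simp: supp2_def r_def split: if_splits)
  have clash: False if "u \<in> C" "v \<in> ?C'" "u \<in> {(x - 1, y), (x, y - 1), (x, y)}"
    "v \<in> {(x - 1, y), (x, y - 1), (x, y)}" for u v x y
  proof -
    have "u \<noteq> v" using that by auto
    then have "adjacent u v" using that(3,4) by (auto simp: adjacent_def)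
    then show False using that C(3) by blast
  qed
  have touch: "\<exists>u\<in>E. u \<in> {(x - 1, y), (x, y - 1), (x, y)}" if "times_S (r E) x y \<noteq> 0" for E x y
    using that by (auto simp: times_S_def r_def split: if_splits)
  have disj: "times_S (r C) x y = 0 \<or> times_S (r ?C') x y = 0" for x y
    using touch[of C x y] touch[of ?C' x y] clash by blast
  have add: "times_S (r C) x y + times_S (r ?C') x y = times_S q x y" for x y
  proof -
    have "r C x y + r ?C' x y = q x y" for x y using C(1) by (auto simp: r_def supp2_def)
    from this[of "x - 1" y] this[of x "y - 1"] this[of x y] show ?thesis
      unfolding times_S_def by linarith
  qed
  \<comment> \<open>As no position receives contributions from both parts, nothing cancels and each
    product is supported inside \<open>P\<close>.\<close>
  have sub: "supp2 (times_S (r E)) \<subseteq> (\<lambda>a. (int (a 0), int (a 1))) ` supp P" if "E = C \<or> E = ?C'" for E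
  proof -
    have "times_S q x y \<noteq> 0" if "times_S (r E) x y \<noteq> 0" for x y
      using that \<open>E = C \<or> E = ?C'\<close> disj[of x y] add[of x y] by fastforce
    then show ?thesis unfolding supp[symmetric] by (auto simp: supp2_def)
  qed
  have deg: "x + y + 1 \<le> int D" if "(x, y) \<in> supp2 q" for x y
  proof (rule quotient_degree_le[OF fin _ that])
    fix x y assume "(x, y) \<in> supp2 (times_S q)"
    then obtain a where "a \<in> supp P" "x = int (a 0)" "y = int (a 1)" unfolding supp by auto
    then show "x + y \<le> int D" using D by (force simp: tdeg_def sum_atMost_2)
  qed
  have F: "F E \<in> I_set 2 \<and> F E \<noteq> (\<lambda>_. 0)" if E: "E = C \<or> E = ?C'" for E
  proof
    have E': "E \<subseteq> supp2 q" "E \<noteq> {}" using C that by auto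
    have finE: "finite (supp2 (r E))" using E' fin by (simp add: suppr finite_subset)
    show "F E \<in> I_set 2"
      unfolding F_def using finP mono D finE sub[OF E] pos deg E'
      by (intro times_S_in_I_set[where D = D]) (auto simp: suppr)
    have "supp2 (times_S (r E)) \<noteq> {}" using finE E' by (intro times_S_nonzero) (auto simp: suppr)
    then obtain a where "a \<in> supp P" "times_S (r E) (int (a 0)) (int (a 1)) \<noteq> 0"
      using sub[OF E] by (force simp: supp2_def)
    then have "F E a \<noteq> 0" unfolding F_def by simp
    then show "F E \<noteq> (\<lambda>_. 0)" by auto
  qed
  have "P = (\<lambda>a. F C a + F ?C' a)"
  proof
    fix a
    show "P a = F C a + F ?C' a"
    proof (cases "a \<in> supp P")
      case True
      then show ?thesis unfolding F_def using add at[OF True] by simp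
    next
      case False
      then show ?thesis by (simp add: F_def supp_def)
    qed
  qed
  moreover have "supp (F C) \<inter> supp (F ?C') = {}"
  proof (rule equals0I)
    fix a assume "a \<in> supp (F C) \<inter> supp (F ?C')"
    then have "F C a \<noteq> 0" "F ?C' a \<noteq> 0" by (simp_all add: supp_def[of "F _"])
    then show False using disj[of "int (a 0)" "int (a 1)"] unfolding F_def by metis
  qed
  moreover have "F C \<in> I_set 2 \<and> F C \<noteq> (\<lambda>_. 0)" "F ?C' \<in> I_set 2 \<and> F ?C' \<noteq> (\<lambda>_. 0)"
    using F by simp_all
  ultimately have "\<exists>P1 P2. P1 \<in> I_set 2 \<and> P2 \<in> I_set 2 \<and> P1 \<noteq> (\<lambda>_. 0) \<and> P2 \<noteq> (\<lambda>_. 0) \<and>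
      P = (\<lambda>a. P1 a + P2 a) \<and> supp P1 \<inter> supp P2 = {}"
    by (intro exI[of _ "F C"] exI[of _ "F ?C'"] conjI) simp_all
  then show False using ind unfolding indecomposable_def by (elim conjE notE)
qed

section \<open>The p-degree and the final estimate\<close>

lemma p_degree_le:
  assumes P: "is_poly 2 P" and D: "\<And>a. a \<in> supp P \<Longrightarrow> tdeg 2 a = D"
    and \<alpha>: "is_mono 2 \<alpha>" "\<And>a i. a \<in> supp P \<Longrightarrow> \<alpha> i \<le> a i"
  shows "p_degree 2 P \<le> D - tdeg 2 \<alpha>"
proof -
  \<comment> \<open>The quotient of \<open>P\<close> by the monomial with exponents
    \<open>\<alpha>\<close>.\<close>
  define R where "R b = P (\<lambda>i. b i + \<alpha> i)" for b
  have R: "(\<lambda>i. b i + \<alpha> i) \<in> supp P" if "b \<in> supp R" for b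
    using that by (simp add: supp_def R_def)
  have "P = mono_mult \<alpha> R"
    using \<alpha>(2) by (auto simp: mono_mult_def R_def supp_def fun_eq_iff)
  moreover have "is_poly 2 R"
  proof -
    have "supp R \<subseteq> (\<lambda>a i. a i - \<alpha> i) ` supp P" using R by force
    then have "finite (supp R)" using P finite_surj by (auto simp: is_poly_def)
    moreover have "is_mono 2 b" if "b \<in> supp R" for b
      using R[OF that] P by (force simp: is_poly_def is_mono_def)
    ultimately show ?thesis by (simp add: is_poly_def)
  qed
  ultimately have "p_degree 2 P \<le> poly_degree 2 R"
    unfolding p_degree_def using \<alpha>(1) by (intro Least_le) blast
  also have "\<dots> \<le> D - tdeg 2 \<alpha>"
  proof -
    have "tdeg 2 b \<le> D - tdeg 2 \<alpha>" if "b \<in> supp R" for b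
      using D[OF R[OF that]] by (simp add: tdeg_def sum.distrib)
    then show ?thesis
      unfolding poly_degree_def using \<open>is_poly 2 R\<close> by (subst Max_le_iff) (auto simp: is_poly_def)
  qed
  finally show ?thesis .
qed

theorem mainTheorem3:
  fixes P :: rpoly and d :: nat
  assumes "P \<in> I_set 2"
    and "P \<noteq> (\<lambda>_. 0)"
    and "indecomposable 2 P"
    and "p_degree 2 P = d"
  shows "int d \<le> 2 * int (Nmon P) - 5"
proof -
  have poly: "is_poly 2 P" and "homogeneous 2 P" using assms(1) by (auto simp: I_set_def)
  then obtain D where D: "\<And>a. a \<in> supp P \<Longrightarrow> tdeg 2 a = D" by (auto simp: homogeneous_def)
  have finP: "finite (supp P)" and mono: "\<And>a. a \<in> supp P \<Longrightarrow> is_mono 2 a"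
    using poly by (auto simp: is_poly_def)
  have ne: "supp P \<noteq> {}" using assms(2) by (auto simp: supp_def)
  obtain q where q: "finite (supp2 q)" "\<And>x y. (x, y) \<in> supp2 q \<Longrightarrow> 0 \<le> x \<and> 0 \<le> y"
    "\<And>a. a \<in> supp P \<Longrightarrow> times_S q (int (a 0)) (int (a 1)) = P a"
    "supp2 (times_S q) = (\<lambda>a. (int (a 0), int (a 1))) ` supp P"
    using I_set_2_quotient[OF assms(1) D] by blast
  have conn: "lattice_connected (supp2 q)"
    by (rule lattice_connected_quotient[OF assms(3) D q])
  have "inj_on (\<lambda>a. (int (a 0), int (a 1))) (supp P)"
    using mono D by (intro inj_onI mono_2_eqI) auto
  then have card: "card (supp2 (times_S q)) = Nmon P"
    unfolding q(4) Nmon_def by (rule card_image)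

  \<comment> \<open>The exponents of the greatest common monomial factor of \<open>P\<close>;
    dividing it out bounds the p-degree.\<close>
  define \<mu> where "\<mu> i = (if i \<le> 2 then Min ((\<lambda>a. a i) ` supp P) else 0)" for i :: nat
  have attained: "\<exists>a\<in>supp P. a i = \<mu> i" if "i \<le> 2" for i
  proof -
    have "\<mu> i \<in> (\<lambda>a. a i) ` supp P" using finP ne that by (simp add: \<mu>_def)
    then show ?thesis by auto
  qed
  have "\<mu> i \<le> a i" if "a \<in> supp P" for a i
    using that finP by (simp add: \<mu>_def)
  then have d: "d \<le> D - tdeg 2 \<mu>"
    using p_degree_le[OF poly D, of \<mu>] assms(4) by (simp add: is_mono_def \<mu>_def)

  \<comment> \<open>A nonzero coefficient of \<open>P\<close> needs a nonzero corner of its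
    triangle. This carries the extreme exponents of \<open>P\<close> over to \<open>q\<close>, with
    a loss of 1 in the total exponent because \<open>q\<close> has one degree less.\<close>
  have near: "\<exists>(x, y)\<in>supp2 q. x \<le> int (a 0) \<and> y \<le> int (a 1) \<and> int (a 0 + a 1) \<le> x + y + 1"
    if "a \<in> supp P" for a
  proof -
    have "times_S q (int (a 0)) (int (a 1)) \<noteq> 0" using q(3)[OF that] that by (simp add: supp_def)
    then have "q (int (a 0) - 1) (int (a 1)) \<noteq> 0 \<or> q (int (a 0)) (int (a 1) - 1) \<noteq> 0
        \<or> q (int (a 0)) (int (a 1)) \<noteq> 0"
      by (auto simp: times_S_def)
    then show ?thesis by (force simp: supp2_def)
  qed
  obtain a where "a \<in> supp P" "a 0 = \<mu> 0" using attained by blast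
  then obtain x y where x: "(x, y) \<in> supp2 q" "x \<le> int (\<mu> 0)" using near by fastforce
  obtain b where "b \<in> supp P" "b 1 = \<mu> 1" using attained[of 1] by auto
  then obtain x1 y1 where y1: "(x1, y1) \<in> supp2 q" "y1 \<le> int (\<mu> 1)" using near by fastforce
  obtain c where c: "c \<in> supp P" "c 2 = \<mu> 2" using attained by blast
  then obtain x2 y2 where z: "(x2, y2) \<in> supp2 q" "int (c 0 + c 1) \<le> x2 + y2 + 1"
    using near by fastforce
  have c01: "c 0 + c 1 + \<mu> 2 = D" using D[OF c(1)] c(2) by (simp add: tdeg_def sum_atMost_2)
  define x0 where "x0 = Min (fst ` supp2 q)"
  have "x0 \<in> fst ` supp2 q" unfolding x0_def using q(1) x(1) by (intro Min_in) auto
  then obtain w where w: "(x0, w) \<in> supp2 q" by auto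
  have min: "x0 \<le> fst u" if "u \<in> supp2 q" for u unfolding x0_def using q(1) that by simp
  \<comment> \<open>Of the constant 6, one unit pays for the loss in \<open>z(2)\<close>; the
    remaining 5 is the constant of the theorem.\<close>
  have "x2 + y2 - x0 - y1 + 6 \<le> 2 * int (Nmon P)"
    using card_supp2_times_S_ge[OF q(1) conn w min y1(1) z(1)] card by simp
  moreover have "x0 \<le> int (\<mu> 0)" using min[OF x(1)] x(2) by simp
  moreover have "tdeg 2 \<mu> = \<mu> 0 + \<mu> 1 + \<mu> 2" by (simp add: tdeg_def sum_atMost_2)
  \<comment> \<open>Together with \<open>c01\<close> this gives \<open>tdeg 2 \<mu> \<le> D\<close>,
    so the natural-number subtraction in \<open>d\<close> is a true difference.\<close>
  moreover have "\<mu> 0 + \<mu> 1 \<le> c 0 + c 1"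
    using \<open>\<And>i a. a \<in> supp P \<Longrightarrow> \<mu> i \<le> a i\<close> c(1) by (simp add: add_mono)
  ultimately show ?thesis using d z(2) y1(2) c01 by linarith
qed

end
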